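(* If $n-1>d>1$ and there exists a real flat ETF with parameters $(d,n)$, then $$\Bigl[\tfrac{d(n-1)}{n-d}\Bigr]^{\frac12},\qquad \Bigl[\tfrac{(n-d)(n-1)}{d}\Bigr]^{\frac12},\qquad \Bigl[\tfrac{d(n-d)}{n-1}\Bigr]^{\frac12}$$ are integers, and are necessarily odd, odd and even, respectively. Moreover, $n$ is divisible by $16$.
   Context: A sequence of vectors $\{\varphi_j\}_{j=1}^n$ in $\mathbb{R}^d$ with synthesis operator $\mathbf\Phi$ (the $d\times n$ matrix whose $j$th column is $\varphi_j$) is a (real) equiangular tight frame (ETF) for $\mathbb{R}^d$, with parameters $(d,n)$, if there exist $\beta>0$, $\gamma\ge0$, $\alpha>0$ such that $\|\varphi_j\|^2=\beta$ for all $j$, $|\langle\varphi_j,\varphi_{j'}\rangle|=\gamma$ for all $j\ne j'$, and $\mathbf{\Phi}\mathbf{\Phi}^{\mathrm T}=\alpha\mathbf{I}$. It is flat if every entry of $\mathbf\Phi$ is $\pm1$. *)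

theory Defs imports "HOL-Analysis.Analysis" begin

definition synthesis_matrix :: "('n::finite \<Rightarrow> real ^ 'd::finite) \<Rightarrow> real ^ 'n ^ 'd" where
  "synthesis_matrix \<phi> = (\<chi> i j. \<phi> j $ i)"

(* The parameters (d, n) are (CARD('d), CARD('n)). *)
definition is_real_etf :: "('n::finite \<Rightarrow> real ^ 'd::finite) \<Rightarrow> bool" where
  "is_real_etf \<phi> \<longleftrightarrow>
     (\<exists>\<beta> \<gamma> \<alpha> :: real. \<beta> > 0 \<and> \<gamma> \<ge> 0 \<and> \<alpha> > 0 \<and>
        (\<forall>j. (norm (\<phi> j))\<^sup>2 = \<beta>) \<and>
        (\<forall>j j'. j \<noteq> j' \<longrightarrow> \<bar>\<phi> j \<bullet> \<phi> j'\<bar> = \<gamma>) \<and>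
        synthesis_matrix \<phi> ** transpose (synthesis_matrix \<phi>) = \<alpha> *\<^sub>R mat 1)"

definition is_flat :: "('n::finite \<Rightarrow> real ^ 'd::finite) \<Rightarrow> bool" where
  "is_flat \<phi> \<longleftrightarrow> (\<forall>i j. synthesis_matrix \<phi> $ i $ j \<in> {1, -1})"

end

theory Submission imports Defs begin

text \<open>
  Write the frame as a sign matrix with integer Gram matrix \<open>g\<close>, whose off-diagonal entries are
  \<open>\<plusminus>c\<close>. Tightness gives \<open>g\<^sup>2 = n g\<close>; comparing diagonal entries yields
  \<open>c\<^sup>2 (n - 1) = d (n - d)\<close>, and comparing off-diagonal entries shows that \<open>c\<close> divides \<open>n - 2d\<close>.
  Hence \<open>a = d / c\<close> and \<open>b = (n - d) / c\<close> have product \<open>n - 1\<close> and integral difference, so they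
  are themselves integers, and the three square roots are \<open>a\<close>, \<open>b\<close> and \<open>c\<close>.
  For three sign vectors of length \<open>k\<close>, the sum of the pairwise inner products is \<open>-k\<close> modulo 4.
  For rows this gives \<open>4 dvd n\<close>. For columns it would force, if \<open>c\<close> were odd, all triangles of
  the sign graph of \<open>g\<close> to have the same parity, so that \<open>\<bar>b - a\<bar> = n - 2\<close>, whence \<open>c = 1\<close> and
  \<open>d\<close> is \<open>1\<close> or \<open>n - 1\<close>. Finally \<open>n = c (a + b)\<close> with \<open>a b = n - 1\<close> lifts \<open>4 dvd n\<close> first to
  \<open>8 dvd n\<close> and then to \<open>16 dvd n\<close>.
\<close>

text \<open>Termwise, \<open>1 + x y + x z + y z\<close> is 4 when the three signs agree and 0
  otherwise.\<close>

lemma sum_pairwise_products_signs: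
  fixes x y z :: "'i \<Rightarrow> int"
  assumes "\<And>i. x i \<in> {1, -1}" "\<And>i. y i \<in> {1, -1}" "\<And>i. z i \<in> {1, -1}"
  shows "4 dvd int (card A) + (\<Sum>i\<in>A. x i * y i) + (\<Sum>i\<in>A. x i * z i) + (\<Sum>i\<in>A. y i * z i)"
proof -
  have "4 dvd 1 + x i * y i + x i * z i + y i * z i" for i
    using assms(1,2,3)[of i] by auto
  then have "4 dvd (\<Sum>i\<in>A. 1 + x i * y i + x i * z i + y i * z i)"
    by (intro dvd_sum) auto
  then show ?thesis
    by (simp add: sum.distrib)
qed

text \<open>Completing the square, \<open>n^2 = (n - 2 d)^2 + 4 d (n - d)\<close>, exhibits
  \<open>n^2\<close> as a multiple of \<open>c^2\<close>. With \<open>t = n / c\<close>, the factors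
  are \<open>(t - m) / 2\<close> and \<open>(t + m) / 2\<close>.\<close>

lemma factor_parameters:
  fixes n d c m :: int
  assumes eq: "c\<^sup>2 * (n - 1) = d * (n - d)" and cm: "c * m = n - 2 * d" and "c > 0"
  obtains a b where "d = c * a" "n - d = c * b" "a * b = n - 1" "b - a = m"
proof -
  have "n\<^sup>2 = (n - 2 * d)\<^sup>2 + 4 * (d * (n - d))"
    by (simp add: power2_eq_square algebra_simps)
  also have "\<dots> = c\<^sup>2 * (4 * (n - 1) + m\<^sup>2)"
    unfolding eq[symmetric] cm[symmetric] by (simp add: power_mult_distrib algebra_simps)
  finally have sq: "n\<^sup>2 = c\<^sup>2 * (4 * (n - 1) + m\<^sup>2)" .
  then have "c\<^sup>2 dvd n\<^sup>2" by simp
  then have "c dvd n" by simp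
  then obtain t where t: "n = c * t" by blast
  have "t\<^sup>2 = 4 * (n - 1) + m\<^sup>2"
    using sq \<open>c > 0\<close> unfolding t by (simp add: power_mult_distrib)
  \<comment> \<open>The squares differ by a multiple of 4, so \<open>t\<close> and \<open>m\<close>
    have equal parity and the halves are integers.\<close>
  then have "even (t\<^sup>2) = even (m\<^sup>2)" by simp
  then have "even (t - m)" by simp
  then obtain a where a: "t - m = 2 * a" by blast
  have "2 * d = c * (t - m)" using t cm by (simp add: algebra_simps)
  then have d: "d = c * a" using a by simp
  have nd: "n - d = c * (a + m)" using d t a by (simp add: algebra_simps)
  have "c\<^sup>2 * (n - 1) = c\<^sup>2 * (a * (a + m))"
    unfolding eq nd by (simp add: d power2_eq_square)
  then have "a * (a + m) = n - 1" using \<open>c > 0\<close> by simp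
  then show thesis using d nd that[of a "a + m"] by simp
qed

text \<open>Every unit modulo 4 or 8 is its own inverse, so \<open>a b = -1\<close> forces
  \<open>b = -a\<close> there. Each such divisibility of \<open>a + b\<close> gains a factor 2 from
  the even \<open>c\<close>.\<close>

lemma dvd_16_of_factorization:
  fixes n a b c :: int
  assumes n: "n = c * (a + b)" and ab: "a * b = n - 1" and "4 dvd n" and "even c"
  shows "16 dvd n"
proof -
  have step4: "4 dvd a + b" if "4 dvd a * b + 1"
  proof -
    have "(a mod 4) * (b mod 4) mod 4 = 3"
      using that by (simp add: mod_mult_eq) presburger
    moreover have "a mod 4 \<in> {0,1,2,3}" "b mod 4 \<in> {0,1,2,3}" by auto
    ultimately have "(a mod 4 + b mod 4) mod 4 = 0" by auto
    then show ?thesis by (simp add: mod_add_eq mod_eq_0_iff_dvd)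
  qed
  have step8: "8 dvd a + b" if "8 dvd a * b + 1"
  proof -
    have "(a mod 8) * (b mod 8) mod 8 = 7"
      using that by (simp add: mod_mult_eq) presburger
    moreover have "a mod 8 \<in> {0,1,2,3,4,5,6,7}" "b mod 8 \<in> {0,1,2,3,4,5,6,7}" by auto
    ultimately have "(a mod 8 + b mod 8) mod 8 = 0" by auto
    then show ?thesis by (simp add: mod_add_eq mod_eq_0_iff_dvd)
  qed
  have "2 * 4 dvd n"
    unfolding n using step4 ab \<open>4 dvd n\<close> \<open>even c\<close> by (intro mult_dvd_mono) auto
  then have "2 * 8 dvd n"
    unfolding n using step8 ab \<open>even c\<close> n by (intro mult_dvd_mono) auto
  then show ?thesis by simp
qed

text \<open>Associativity: for G = F^T F with F F^T = n I, one has G^2 = F^T (F F^T) F = n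
  G.\<close>

lemma gram_square_of_orthogonal_rows:
  fixes F :: "'d::finite \<Rightarrow> 'n::finite \<Rightarrow> int"
  assumes "\<And>i i'. (\<Sum>k\<in>UNIV. F i k * F i' k) = (if i = i' then n else 0)"
  shows "(\<Sum>k\<in>UNIV. (\<Sum>i\<in>UNIV. F i j * F i k) * (\<Sum>i\<in>UNIV. F i k * F i l)) =
    n * (\<Sum>i\<in>UNIV. F i j * F i l)"
proof -
  have "(\<Sum>k\<in>UNIV. (\<Sum>i\<in>UNIV. F i j * F i k) * (\<Sum>i\<in>UNIV. F i k * F i l)) =
      (\<Sum>k\<in>UNIV. \<Sum>i\<in>UNIV. \<Sum>i'\<in>UNIV. F i j * F i' l * (F i k * F i' k))"
    by (simp add: sum_product mult_ac)
  also have "\<dots> = (\<Sum>i\<in>UNIV. \<Sum>k\<in>UNIV. \<Sum>i'\<in>UNIV. F i j * F i' l * (F i k * F i' k))"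
    by (rule sum.swap)
  also have "\<dots> = (\<Sum>i\<in>UNIV. \<Sum>i'\<in>UNIV. \<Sum>k\<in>UNIV. F i j * F i' l * (F i k * F i' k))"
    by (intro sum.cong refl sum.swap)
  also have "\<dots> = (\<Sum>i\<in>UNIV. \<Sum>i'\<in>UNIV. F i j * F i' l * (if i = i' then n else 0))"
    by (simp only: sum_distrib_left[symmetric] assms)
  also have "\<dots> = n * (\<Sum>i\<in>UNIV. F i j * F i l)"
    by (simp add: sum_distrib_left if_distrib[of "(*) _"] mult_ac cong: if_cong)
  finally show ?thesis .
qed

text \<open>Integer core of the theorem: the factorizations turn the three radicands into
  \<open>a^2\<close>, \<open>b^2\<close> and \<open>c^2\<close>.\<close>

lemma sign_etf_parameters:
  fixes F :: "'d::finite \<Rightarrow> 'n::finite \<Rightarrow> int" and c :: int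
  defines "d \<equiv> int CARD('d)" and "n \<equiv> int CARD('n)"
  assumes signs: "\<And>i j. F i j \<in> {1, -1}"
    and rows: "\<And>i i'. i \<noteq> i' \<Longrightarrow> (\<Sum>k\<in>UNIV. F i k * F i' k) = 0"
    and cols: "\<And>j k. j \<noteq> k \<Longrightarrow> \<bar>\<Sum>i\<in>UNIV. F i j * F i k\<bar> = c"
    and "d > 1" "n - 1 > d"
  obtains a b where "a > 0" "b > 0" "c > 0" "d = c * a" "n - d = c * b" "a * b = n - 1"
    "odd a" "odd b" "even c" "16 dvd n"
proof -
  define g where "g j k = (\<Sum>i\<in>UNIV. F i j * F i k)" for j k
  define s where "s j k = sgn (g j k)" for j k
  have sq1: "F i j * F i j = 1" for i j using signs[of i j] by auto
  have gram: "(\<Sum>k\<in>UNIV. g j k * g k l) = n * g j l" for j l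
    unfolding g_def
    by (rule gram_square_of_orthogonal_rows) (simp add: rows sq1 n_def)
  have g_diag: "g j j = d" for j by (simp add: g_def sq1 d_def)
  have g_sym: "g j k = g k j" for j k by (simp add: g_def mult.commute)
  have g_abs: "\<bar>g j k\<bar> = c" if "j \<noteq> k" for j k using cols[OF that] by (simp add: g_def)
  have "\<not> CARD('n) \<le> Suc 0" using \<open>d > 1\<close> \<open>n - 1 > d\<close> n_def by linarith
  then obtain p q :: 'n where "p \<noteq> q"
    by (metis card_le_Suc0_iff_eq finite UNIV_I)
  have "c \<ge> 0" using g_abs[OF \<open>p \<noteq> q\<close>] by linarith

  \<comment> \<open>The diagonal entry of \<open>g^2 = n g\<close> at \<open>p\<close>.\<close>
  have "n * d = (\<Sum>k\<in>UNIV. g p k * g k p)" by (simp add: gram g_diag)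
  also have "\<dots> = g p p * g p p + (\<Sum>k\<in>UNIV - {p}. g p k * g k p)"
    by (subst sum.remove[of _ p]) auto
  also have "(\<Sum>k\<in>UNIV - {p}. g p k * g k p) = (\<Sum>k\<in>UNIV - {p}. c\<^sup>2)"
  proof (rule sum.cong[OF refl])
    fix k assume "k \<in> UNIV - {p}"
    then have "\<bar>g p k\<bar> = c" by (intro g_abs) auto
    then show "g p k * g k p = c\<^sup>2"
      by (metis g_sym power2_abs power2_eq_square)
  qed
  also have "\<dots> = (n - 1) * c\<^sup>2"
    by (simp add: n_def card_Diff_singleton of_nat_diff Suc_leI)
  finally have diag: "c\<^sup>2 * (n - 1) = d * (n - d)"
    by (simp add: g_diag algebra_simps power2_eq_square)

  have "c \<noteq> 0" using diag \<open>d > 1\<close> \<open>n - 1 > d\<close> by auto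
  with \<open>c \<ge> 0\<close> have "c > 0" by simp
  have s_sign: "s j k \<in> {1, -1}" and g_eq: "g j k = c * s j k" if "j \<noteq> k" for j k
    using g_abs[OF that] \<open>c > 0\<close> by (auto simp: s_def sgn_if split: if_splits)

  \<comment> \<open>\<open>T\<close> collects the \<open>(p, q)\<close> entry of the squared sign
    matrix away from the terms \<open>k = p\<close> and \<open>k = q\<close>, which meet the
    diagonal \<open>d\<close> of \<open>g\<close> and together give
    \<open>2 d g p q\<close>.\<close>
  define T where "T = (\<Sum>k\<in>UNIV - {p, q}. s p k * s k q)"
  have "n * (c * s p q) = (\<Sum>k\<in>UNIV. g p k * g k q)"
    using gram g_eq[OF \<open>p \<noteq> q\<close>] by simp
  also have "\<dots> = (\<Sum>k\<in>UNIV - {p, q}. g p k * g k q) + (\<Sum>k\<in>{p, q}. g p k * g k q)"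
    by (rule sum.subset_diff) auto
  also have "(\<Sum>k\<in>UNIV - {p, q}. g p k * g k q) = (\<Sum>k\<in>UNIV - {p, q}. c * c * (s p k * s k q))"
    by (intro sum.cong refl) (auto simp: g_eq)
  also have "\<dots> = c * c * T" by (simp add: T_def sum_distrib_left)
  also have "(\<Sum>k\<in>{p, q}. g p k * g k q) = 2 * d * (c * s p q)"
    using \<open>p \<noteq> q\<close> by (simp add: g_diag g_eq)
  finally have "c * (c * T) = c * ((n - 2 * d) * s p q)"
    by (simp add: algebra_simps)
  then have "c * T = (n - 2 * d) * s p q" using \<open>c > 0\<close> by simp
  then have off: "c * (T * s p q) = n - 2 * d"
    using s_sign[OF \<open>p \<noteq> q\<close>] by auto

  obtain a b where ab: "d = c * a" "n - d = c * b" "a * b = n - 1" "b - a = T * s p q"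
    using factor_parameters[OF diag off \<open>c > 0\<close>] by blast
  have "a > 0" "b > 0"
    using ab(1,2) \<open>c > 0\<close> \<open>d > 1\<close> \<open>n - 1 > d\<close> zero_less_mult_pos[of c a] zero_less_mult_pos[of c b]
    by auto

  \<comment> \<open>Needed to have three distinct rows for the congruence modulo 4.\<close>
  have "d \<noteq> 2"
  proof
    assume "d = 2"
    with diag have "2 = (n - 1) * (2 - c\<^sup>2)" by (simp add: algebra_simps)
    then have "n - 1 dvd 2" by (metis dvd_triv_left)
    then show False using zdvd_imp_le[of "n - 1" 2] \<open>n - 1 > d\<close> \<open>d = 2\<close> by simp
  qed
  with \<open>d > 1\<close> have "3 \<le> CARD('d)" by (simp add: d_def)
  then obtain D :: "'d set" where "card D = 3"
    by (meson obtain_subset_with_card_n)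
  then obtain u v w :: 'd where "u \<noteq> v" "u \<noteq> w" "v \<noteq> w" by (auto simp: card_3_iff)
  then have "4 dvd n"
    using sum_pairwise_products_signs[where x = "F u" and y = "F v" and z = "F w" and A = UNIV]
      signs rows by (simp add: n_def)
  then have "even n" by presburger
  then have "odd (a * b)" using ab(3) by simp
  then have "odd a" "odd b" by auto

  have "even c"
  proof (rule ccontr)
    assume "odd c"
    \<comment> \<open>The sum of three signs modulo 4 determines their product: sum 3 or -1 gives
      product 1, sum 1 or -3 gives -1. As the sum is \<open>-a\<close> modulo 4, \<open>e\<close> is
      the common product over all triangles through \<open>p\<close> and \<open>q\<close>.\<close>
    define e :: int where "e = (if a mod 4 = 1 then 1 else -1)"
    have tri: "s p k * s k q = e * s p q" if "k \<in> UNIV - {p, q}" for k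
    proof -
      have k: "p \<noteq> k" "k \<noteq> q" using that by auto
      have "4 dvd d + g p k + g p q + g k q"
        using sum_pairwise_products_signs[where x = "\<lambda>i. F i p" and y = "\<lambda>i. F i k" and z = "\<lambda>i. F i q"
            and A = UNIV] signs by (simp add: g_def d_def)
      then have "4 dvd c * (a + s p k + s p q + s k q)"
        using g_eq[OF k(1)] g_eq[OF k(2)] g_eq[OF \<open>p \<noteq> q\<close>] ab(1) by (simp add: algebra_simps)
      moreover have "coprime 4 c"
        using \<open>odd c\<close> coprime_power_left_iff[of 2 2 c] by simp
      ultimately have "4 dvd a + s p k + s p q + s k q"
        by (simp add: coprime_dvd_mult_right_iff)
      then show ?thesis
        using s_sign[OF k(1)] s_sign[OF k(2)] s_sign[OF \<open>p \<noteq> q\<close>] \<open>odd a\<close>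
        unfolding e_def by auto presburger+
    qed
    have "T = (\<Sum>k\<in>UNIV - {p, q}. e * s p q)"
      unfolding T_def by (intro sum.cong refl tri)
    also have "\<dots> = (n - 2) * e * s p q"
    proof -
      have "card (UNIV - {p, q}) = CARD('n) - 2"
        using \<open>p \<noteq> q\<close> by (subst card_Diff_subset) auto
      moreover have "2 \<le> CARD('n)" using \<open>\<not> CARD('n) \<le> Suc 0\<close> by simp
      ultimately show ?thesis by (simp add: n_def of_nat_diff)
    qed
    finally have "b - a = (n - 2) * e"
      using ab(4) s_sign[OF \<open>p \<noteq> q\<close>] by auto
    then consider "b = a + (n - 2)" | "a = b + (n - 2)" by (auto simp: e_def split: if_splits)
    then have "a + b = n \<and> (a = 1 \<or> b = 1)"
    proof cases
      case 1
      \<comment> \<open>Substituting for \<open>b\<close> in \<open>a b = n - 1\<close> gives a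
        quadratic in \<open>a\<close> whose other root \<open>1 - n\<close> is negative.\<close>
      then have "(a - 1) * (a + n - 1) = 0" using ab(3) unfolding 1 by (simp add: algebra_simps)
      then show ?thesis using 1 \<open>a > 0\<close> \<open>n - 1 > d\<close> \<open>d > 1\<close> by auto
    next
      case 2
      then have "(b - 1) * (b + n - 1) = 0" using ab(3) unfolding 2 by (simp add: algebra_simps)
      then show ?thesis using 2 \<open>b > 0\<close> \<open>n - 1 > d\<close> \<open>d > 1\<close> by auto
    qed
    moreover have "n = c * (a + b)" using ab(1,2) by (simp add: algebra_simps)
    ultimately have "c = 1" "a = 1 \<or> b = 1" using \<open>n - 1 > d\<close> \<open>d > 1\<close> by auto
    then show False using ab(1,2) \<open>n - 1 > d\<close> \<open>d > 1\<close> by auto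
  qed
  moreover have "16 dvd n"
    using dvd_16_of_factorization[of n c a b] ab \<open>4 dvd n\<close> \<open>even c\<close> by (simp add: algebra_simps)
  ultimately show thesis
    using that ab(1-3) \<open>a > 0\<close> \<open>b > 0\<close> \<open>c > 0\<close> \<open>odd a\<close> \<open>odd b\<close> by blast
qed

theorem corollary3:
  fixes d n :: nat
  assumes d_def: "d = CARD('d::finite)" and n_def: "n = CARD('n::finite)"
    and bounds: "n - 1 > d" "d > 1"
    and ex: "\<exists>\<phi> :: 'n \<Rightarrow> real ^ 'd. is_real_etf \<phi> \<and> is_flat \<phi>"
  shows "(\<exists>a b c :: int.
            sqrt (real d * (real n - 1) / (real n - real d)) = of_int a \<and> odd a \<and>
            sqrt ((real n - real d) * (real n - 1) / real d) = of_int b \<and> odd b \<and>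
            sqrt (real d * (real n - real d) / (real n - 1)) = of_int c \<and> even c) \<and>
         16 dvd n"
proof -
  obtain \<phi> :: "'n \<Rightarrow> real ^ 'd" and \<gamma> \<alpha> :: real
    where equi: "\<And>j j'. j \<noteq> j' \<Longrightarrow> \<bar>\<phi> j \<bullet> \<phi> j'\<bar> = \<gamma>"
      and tight: "synthesis_matrix \<phi> ** transpose (synthesis_matrix \<phi>) = \<alpha> *\<^sub>R mat 1"
      and flat: "\<And>i j. \<phi> j $ i \<in> {1, -1}"
    using ex unfolding is_real_etf_def is_flat_def synthesis_matrix_def by auto
  \<comment> \<open>Flatness lets the frame be recoded over the integers, where divisibility makes
    sense.\<close>
  define F :: "'d \<Rightarrow> 'n \<Rightarrow> int" where "F i j = (if \<phi> j $ i = 1 then 1 else -1)" for i j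
  have F: "\<phi> j $ i = of_int (F i j)" for i j
    using flat[of j i] by (auto simp: F_def)
  have rows: "(\<Sum>k\<in>UNIV. F i k * F i' k) = 0" if "i \<noteq> i'" for i i'
  proof -
    have "(\<Sum>k\<in>UNIV. \<phi> k $ i * \<phi> k $ i') = (synthesis_matrix \<phi> ** transpose (synthesis_matrix \<phi>)) $ i $ i'"
      by (simp add: matrix_matrix_mult_def transpose_def synthesis_matrix_def)
    also have "\<dots> = 0" using that by (simp add: tight mat_def)
    finally have "real_of_int (\<Sum>k\<in>UNIV. F i k * F i' k) = 0" by (simp add: F)
    then show ?thesis by linarith
  qed
  \<comment> \<open>\<open>\<gamma>\<close> is the absolute value of an integer inner product, so
    the floor only changes its type.\<close>
  have cols: "\<bar>\<Sum>i\<in>UNIV. F i j * F i k\<bar> = \<lfloor>\<gamma>\<rfloor>" if "j \<noteq> k" for j k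
  proof -
    have "\<gamma> = real_of_int \<bar>\<Sum>i\<in>UNIV. F i j * F i k\<bar>"
      using equi[OF that] by (simp add: inner_vec_def F)
    then show ?thesis by linarith
  qed
  have bounds': "int CARD('d) > 1" "int CARD('n) - 1 > int CARD('d)"
    using bounds unfolding d_def n_def by linarith+
  have signs: "F i j \<in> {1, -1}" for i j by (simp add: F_def)
  obtain a b c where pos: "a > 0" "b > 0" "c > 0"
    and d: "int d = c * a" and nd: "int n - int d = c * b" and ab: "a * b = int n - 1"
    and par: "odd a" "odd b" "even c" "16 dvd int n"
    using sign_etf_parameters[OF signs rows cols bounds'] unfolding d_def n_def by metis
  have "real d = of_int c * of_int a" "real n - real d = of_int c * of_int b"
    "real n - 1 = of_int a * of_int b"
    using arg_cong[OF d, of real_of_int] arg_cong[OF nd, of real_of_int]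
      arg_cong[OF ab, of real_of_int] by simp_all
  then have "sqrt (real d * (real n - 1) / (real n - real d)) = sqrt ((of_int a)\<^sup>2)"
    "sqrt ((real n - real d) * (real n - 1) / real d) = sqrt ((of_int b)\<^sup>2)"
    "sqrt (real d * (real n - real d) / (real n - 1)) = sqrt ((of_int c)\<^sup>2)"
    using pos by (simp_all add: power2_eq_square)
  then have "sqrt (real d * (real n - 1) / (real n - real d)) = of_int a"
    "sqrt ((real n - real d) * (real n - 1) / real d) = of_int b"
    "sqrt (real d * (real n - real d) / (real n - 1)) = of_int c"
    using pos by simp_all
  moreover have "16 dvd n"
    using par(4) by presburger
  ultimately show ?thesis using par by blast
qed

end
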